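(* There is no proper metric space $X$ with the property that every proper metric space of asymptotic dimension $\le 1$ admits a coarse embedding in $X$.
   Context: A metric space is called proper if every closed ball in it is compact. Asymptotic dimension: a family $\mathcal A$ of subsets of a metric space $(X,d)$ is uniformly bounded if there is $M>0$ such that $\mathrm{diam}(A)\le M$ for every $A\in\mathcal A$. Given $D>0$, a family $\mathcal A$ of subsets of $X$ is $D$-discrete if $d(A,B)=\inf\{d(a,b)\mid a\in A,\ b\in B\}\ge D$ for every distinct $A,B\in\mathcal A$. For an integer $n\ge 0$, the asymptotic dimension of $X$ is $\le n$ (written $\mathrm{asdim}\,X\le n$) if for every $D>0$ there exists a uniformly bounded cover $\mathcal U$ of $X$ such that $\mathcal U=\bigcup_{i=0}^n\mathcal U_i$, where every $\mathcal U_i$, $i=0,1,\dots,n$, is $D$-discrete. Coarse embedding: write $\mathbb R_+=[0,\infty)$. A map $f\colon X\to Y$ between metric spaces $(X,d_X)$ and $(Y,d_Y)$ is coarsely uniform if there exists a non-decreasing function $\phi\colon\mathbb R_+\to\mathbb R_+$ such that $\lim_{t\to\infty}\phi(t)=\infty$ and $d_Y(f(x),f(y))\le\phi(d_X(x,y))$ for all $x,y\in X$. A coarsely uniform map $f\colon X\to Y$ is a coarse embedding if there exists a non-decreasing function $\psi\colon\mathbb R_+\to\mathbb R_+$ such that $\lim_{t\to\infty}\psi(t)=\infty$ and $d_Y(f(x),f(y))\ge\psi(d_X(x,y))$ for all $x,y\in X$. The maps are not assumed to be continuous. *)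

theory Defs
  imports "HOL-Analysis.Analysis"
begin

definition proper_metric :: "'a metric \<Rightarrow> bool" where
  "proper_metric X \<longleftrightarrow> (\<forall>x\<in>mspace X. \<forall>r. compactin (mtopology_of X) (mcball_of X x r))"

(* Extended values are used for diameters and distances between sets, so that the supremum may be
   infinite and the infimum over an empty set is infinite. No information is lost by ennreal,
   as mdist X is nonnegative. *)

definition set_diam :: "'a metric \<Rightarrow> 'a set \<Rightarrow> ennreal" where
  "set_diam X A = (SUP a\<in>A. SUP b\<in>A. ennreal (mdist X a b))"

definition set_dist :: "'a metric \<Rightarrow> 'a set \<Rightarrow> 'a set \<Rightarrow> ennreal" where
  "set_dist X A B = (INF a\<in>A. INF b\<in>B. ennreal (mdist X a b))"

definition uniformly_bounded :: "'a metric \<Rightarrow> 'a set set \<Rightarrow> bool" where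
  "uniformly_bounded X \<A> \<longleftrightarrow> (\<exists>M>0. \<forall>A\<in>\<A>. set_diam X A \<le> ennreal M)"

definition discrete_family :: "'a metric \<Rightarrow> real \<Rightarrow> 'a set set \<Rightarrow> bool" where
  "discrete_family X D \<A> \<longleftrightarrow> (\<forall>A\<in>\<A>. \<forall>B\<in>\<A>. A \<noteq> B \<longrightarrow> set_dist X A B \<ge> ennreal D)"

definition asdim_le :: "'a metric \<Rightarrow> nat \<Rightarrow> bool" where
  "asdim_le X n \<longleftrightarrow>
    (\<forall>D>0. \<exists>\<U>. \<U> \<subseteq> Pow (mspace X) \<and> \<Union>\<U> = mspace X \<and> uniformly_bounded X \<U> \<and>
      (\<exists>\<V> :: nat \<Rightarrow> 'a set set. \<U> = (\<Union>i\<le>n. \<V> i) \<and> (\<forall>i\<le>n. discrete_family X D (\<V> i))))"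

(* Nondecreasing maps of the half-line [0, infinity) to itself that tend to infinity; the values
   at negative arguments are irrelevant. *)

definition control_function :: "(real \<Rightarrow> real) \<Rightarrow> bool" where
  "control_function \<phi> \<longleftrightarrow>
    \<phi> \<in> {0..} \<rightarrow> {0..} \<and> mono_on {0..} \<phi> \<and> filterlim \<phi> at_top at_top"

definition coarsely_uniform :: "'a metric \<Rightarrow> 'b metric \<Rightarrow> ('a \<Rightarrow> 'b) \<Rightarrow> bool" where
  "coarsely_uniform X Y f \<longleftrightarrow> f \<in> mspace X \<rightarrow> mspace Y \<and>
    (\<exists>\<phi>. control_function \<phi> \<and>
      (\<forall>x\<in>mspace X. \<forall>y\<in>mspace X. mdist Y (f x) (f y) \<le> \<phi> (mdist X x y)))"

definition coarse_embedding :: "'a metric \<Rightarrow> 'b metric \<Rightarrow> ('a \<Rightarrow> 'b) \<Rightarrow> bool" where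
  "coarse_embedding X Y f \<longleftrightarrow> coarsely_uniform X Y f \<and>
    (\<exists>\<psi>. control_function \<psi> \<and>
      (\<forall>x\<in>mspace X. \<forall>y\<in>mspace X. mdist Y (f x) (f y) \<ge> \<psi> (mdist X x y)))"

lemma set_diam_le_iff:
  "0 \<le> M \<Longrightarrow> set_diam X A \<le> ennreal M \<longleftrightarrow> (\<forall>a\<in>A. \<forall>b\<in>A. mdist X a b \<le> M)"
  by (simp add: set_diam_def SUP_le_iff ennreal_le_iff)

lemma set_dist_ge_iff:
  "ennreal D \<le> set_dist X A B \<longleftrightarrow> (\<forall>a\<in>A. \<forall>b\<in>B. D \<le> mdist X a b)"
  by (simp add: set_dist_def le_INF_iff ennreal_le_iff)

(* By the next two facts, the metric spaces carried by sets of reals represent, up to isometry, all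
   proper metric spaces, whatever the type of their points: a statement about all proper metric
   spaces may therefore quantify over real metric. *)

lemma proper_metric_inj_real:
  fixes X :: "'a metric"
  assumes "proper_metric X"
  shows "\<exists>h :: 'a \<Rightarrow> real. inj_on h (mspace X)"
proof (cases "mspace X = {}")
  case False
  then obtain p where p: "p \<in> mspace X" by auto
  interpret Metric_space "mspace X" "mdist X" by simp
  have "mtotally_bounded (mcball p (real n))" for n
    using assms p unfolding proper_metric_def mtopology_of_def mcball_of_def
    by (blast intro: compactin_imp_mtotally_bounded)
  then have "\<forall>n m. \<exists>K. finite K \<and> K \<subseteq> mcball p (real n) \<and>
      mcball p (real n) \<subseteq> (\<Union>x\<in>K. mball x (1 / Suc m))"
    by (simp add: mtotally_bounded_def)
  then obtain K where K: "\<And>n m :: nat. finite (K n m)" "\<And>n m :: nat. K n m \<subseteq> mcball p (real n)"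
    "\<And>n m :: nat. mcball p (real n) \<subseteq> (\<Union>x\<in>K n m. mball x (1 / Suc m))"
    by metis
  define S where "S = (\<Union>n m. K n m)"
  have "countable S" unfolding S_def by (intro countable_UN countableI_type countable_finite K(1))
  have SM: "S \<subseteq> mspace X" using K(2) by (fastforce simp: S_def)
  have dense: "\<exists>s\<in>S. mdist X s x < e" if "x \<in> mspace X" "0 < e" for x e
  proof -
    obtain n :: nat where "mdist X p x \<le> real n" using real_arch_simple by blast
    then have "x \<in> mcball p (real n)" using p that by simp
    moreover obtain m :: nat where m: "1 / Suc m < e" using \<open>0 < e\<close> nat_approx_posE by blast
    ultimately obtain s where s: "s \<in> K n m" "x \<in> mball s (1 / Suc m)" using K(3)[of n m] by blast
    then have "mdist X s x < e" using m by simp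
    moreover have "s \<in> S" using s(1) unfolding S_def by blast
    ultimately show ?thesis by blast
  qed
  define g where "g x = {(s,q). s \<in> S \<and> mdist X s x < real_of_rat q}" for x
  have "inj_on g (mspace X)"
  proof (rule inj_onI, rule ccontr)
    fix x y assume xy: "x \<in> mspace X" "y \<in> mspace X" "g x = g y" "x \<noteq> y"
    then have pos: "0 < mdist X x y" by simp
    then obtain q where q: "0 < real_of_rat q" "real_of_rat q < mdist X x y / 2"
      using of_rat_dense[of 0 "mdist X x y / 2"] by auto
    obtain s where s: "s \<in> S" "mdist X s x < real_of_rat q" using dense xy q by blast
    then have "(s,q) \<in> g y" using xy(3) by (auto simp: g_def)
    then have "mdist X s y < real_of_rat q" by (simp add: g_def)
    moreover have "mdist X x y \<le> mdist X s x + mdist X s y"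
      using triangle''[of x s y] xy s SM by blast
    ultimately show False using s q by linarith
  qed
  moreover have "inj_on (image (to_nat_on (S \<times> (UNIV :: rat set)))) (g ` mspace X)"
  proof (rule inj_on_subset[OF inj_on_image_Pow])
    show "inj_on (to_nat_on (S \<times> (UNIV :: rat set))) (S \<times> UNIV)"
      using \<open>countable S\<close> by (intro inj_on_to_nat_on countable_SIGMA) auto
    show "g ` mspace X \<subseteq> Pow (S \<times> UNIV)" by (auto simp: g_def)
  qed
  ultimately have "inj_on (image (to_nat_on (S \<times> (UNIV :: rat set))) \<circ> g) (mspace X)"
    by (rule comp_inj_on)
  moreover obtain j :: "nat set \<Rightarrow> real" where j: "inj j"
    using nat_sets_eqpoll_reals unfolding eqpoll_def bij_betw_def by blast
  ultimately have "inj_on (j \<circ> (image (to_nat_on (S \<times> (UNIV :: rat set))) \<circ> g)) (mspace X)"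
    by (metis comp_inj_on inj_on_subset subset_UNIV)
  then show ?thesis by blast
qed auto

lemma proper_metric_isometric_real:
  fixes X :: "'a metric"
  assumes "proper_metric X"
  shows "\<exists>(Y :: real metric) h. proper_metric Y \<and> bij_betw h (mspace X) (mspace Y) \<and>
    (\<forall>x\<in>mspace X. \<forall>y\<in>mspace X. mdist Y (h x) (h y) = mdist X x y)"
proof -
  obtain h :: "'a \<Rightarrow> real" where h: "inj_on h (mspace X)"
    using proper_metric_inj_real[OF assms] by blast
  define k where "k = inv_into (mspace X) h"
  have k: "k (h x) = x" if "x \<in> mspace X" for x using h that by (simp add: k_def)
  define d where "d u v = mdist X (k u) (k v)" for u v
  interpret Y: Metric_space "h ` mspace X" d
    by unfold_locales (auto simp: d_def k mdist_commute mdist_triangle)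
  define Y where "Y = metric (h ` mspace X, d)"
  have Y: "mspace Y = h ` mspace X" "mdist Y = d" by (simp_all add: Y_def)
  have iso: "\<forall>x\<in>mspace X. \<forall>y\<in>mspace X. mdist Y (h x) (h y) = mdist X x y"
    by (simp add: Y d_def k)
  have "Lipschitz_continuous_map X Y h"
    unfolding Lipschitz_continuous_map_def using iso by (auto simp: Y(1) intro!: exI[of _ 1])
  then have cont: "continuous_map (mtopology_of X) (mtopology_of Y) h"
    by (rule Lipschitz_continuous_imp_continuous_map)
  have "compactin (mtopology_of Y) (mcball_of Y y r)" if y: "y \<in> mspace Y" for y r
  proof -
    obtain x where x: "x \<in> mspace X" "y = h x" using y unfolding Y(1) by blast
    have "mcball_of Y y r = h ` mcball_of X x r" using x iso by (auto simp: Y(1))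
    then show ?thesis
      using assms x(1) image_compactin[OF _ cont] unfolding proper_metric_def by simp
  qed
  moreover have "bij_betw h (mspace X) (mspace Y)" using h by (simp add: Y bij_betw_def)
  ultimately show ?thesis using iso unfolding proper_metric_def by blast
qed

end

theory Submission
  imports Defs
begin

text \<open>Let a locally finite tree consist of the ray of the natural numbers, with finitely many further
  rays growing out of each of its vertices. It is proper and of asymptotic dimension at most 1. As
  vertices can be joined by chains of unit steps, a coarsely uniform map on it is Lipschitz at large
  scale. The ends of the segments of length \<open>n\<close> that grow out of the vertex \<open>n\<close> are at distance more
  than \<open>2 * n\<close> from each other, but at most about \<open>2 * n\<close> from the root. A coarse embedding
  therefore maps them, for large \<open>n\<close>, to a 1-separated set in a ball whose radius is at most
  quadratic in \<open>n\<close>. By properness of the target there is a bound on the size of such sets, and the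
  number of branches at \<open>n\<close> is chosen in advance to exceed it.\<close>

section \<open>Rays with branches\<close>

text \<open>The point \<open>(b, t)\<close> lies at height \<open>t\<close> on the branch \<open>b\<close>, which is attached to the main ray at
  the position \<open>h b\<close>. The main ray itself is left out: the bases \<open>(b, 0)\<close> of the branches
  represent it, and the summand 1 separates bases attached at the same position.\<close>

definition branch_dist :: "('b \<Rightarrow> nat) \<Rightarrow> 'b \<times> nat \<Rightarrow> 'b \<times> nat \<Rightarrow> real" where
  "branch_dist h x y =
    (if fst x = fst y then \<bar>real (snd x) - real (snd y)\<bar>
     else real (snd x) + real (snd y) + \<bar>real (h (fst x)) - real (h (fst y))\<bar> + 1)"

definition branched_ray :: "'b set \<Rightarrow> ('b \<Rightarrow> nat) \<Rightarrow> ('b \<times> nat) metric" where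
  "branched_ray B h = metric (B \<times> UNIV, branch_dist h)"

lemma Metric_space_branch_dist: "Metric_space S (branch_dist h)"
  by unfold_locales (auto simp: branch_dist_def prod_eq_iff split: if_splits)

lemma mspace_branched_ray [simp]: "mspace (branched_ray B h) = B \<times> UNIV"
  and mdist_branched_ray [simp]: "mdist (branched_ray B h) = branch_dist h"
  by (simp_all add: branched_ray_def Metric_space.mspace_metric Metric_space.mdist_metric
      Metric_space_branch_dist)

text \<open>\<open>h (fst x) + snd x\<close> is the length of the way from the root along the main
  ray and up to \<open>x\<close>. Both the finiteness of balls and the gaps between annuli come from
  it.\<close>

lemma branch_dist_height_diff:
  "\<bar>real (h (fst x) + snd x) - real (h (fst y) + snd y)\<bar> \<le> branch_dist h x y"
  by (auto simp: branch_dist_def)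

text \<open>Closed balls are even finite: a bound on the distance from the root leaves finitely many
  attaching positions, finitely many branches at each, and finitely many heights on them.\<close>

lemma proper_metric_branched_ray:
  assumes "\<And>n. finite {b \<in> B. h b = n}"
  shows "proper_metric (branched_ray B h)"
  unfolding proper_metric_def
proof (intro ballI allI)
  fix x r assume x: "x \<in> mspace (branched_ray B h)"
  define m where "m = nat \<lceil>real (h (fst x) + snd x) + r\<rceil>"
  have fin: "finite ((\<Union>n\<le>m. {b \<in> B. h b = n}) \<times> {..m})"
    using assms by simp
  have "mcball_of (branched_ray B h) x r \<subseteq> (\<Union>n\<le>m. {b \<in> B. h b = n}) \<times> {..m}"
  proof
    fix y assume y: "y \<in> mcball_of (branched_ray B h) x r"
    then have "branch_dist h x y \<le> r" by simp
    then have "real (h (fst y) + snd y) \<le> real (h (fst x) + snd x) + r"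
      using branch_dist_height_diff[of h x y] by linarith
    then have "h (fst y) + snd y \<le> m" unfolding m_def by linarith
    then show "y \<in> (\<Union>n\<le>m. {b \<in> B. h b = n}) \<times> {..m}" using y by (auto simp: mem_Times_iff)
  qed
  then have "finite (mcball_of (branched_ray B h) x r)" using fin finite_subset by blast
  then show "compactin (mtopology_of (branched_ray B h)) (mcball_of (branched_ray B h) x r)"
    by (intro finite_imp_compactin) auto
qed

text \<open>The annulus \<open>i\<close> consists of the points at distance between \<open>i * N\<close> and \<open>(i + 1) * N\<close> from the
  root. Within an annulus, the branches that leave the main ray at least one annulus earlier form
  cells of their own, at height at least \<open>N\<close>; the rest is a single bounded cell.\<close>

definition branch_cell :: "('b \<Rightarrow> nat) \<Rightarrow> nat \<Rightarrow> 'b \<times> nat \<Rightarrow> nat \<times> 'b option" where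
  "branch_cell h N x =
    (let i = (h (fst x) + snd x) div N in (i, if h (fst x) + N \<le> i * N then Some (fst x) else None))"

text \<open>On a cell inside one branch the heights differ by less than \<open>N\<close>. In the
  remaining cell of an annulus both heights are below \<open>2 * N\<close> and the attaching
  positions less than \<open>2 * N\<close> apart; the summand 1 of \<open>branch_dist\<close>
  completes the bound.\<close>

lemma branch_cell_bounded:
  assumes "0 < N" "branch_cell h N x = branch_cell h N y"
  shows "branch_dist h x y \<le> 6 * real N + 1"
proof -
  obtain b s c t where xy: "x = (b, s)" "y = (c, t)" by fastforce
  define i where "i = (h b + s) div N"
  have i: "(h c + t) div N = i" and eq: "h b + N \<le> i * N \<Longrightarrow> b = c"
    "h b + N \<le> i * N \<longleftrightarrow> h c + N \<le> i * N"
    using assms(2) by (auto simp: branch_cell_def xy i_def Let_def split: if_splits)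
  have 1: "i * N \<le> h b + s" "h b + s < i * N + N" "i * N \<le> h c + t" "h c + t < i * N + N"
    using div_times_less_eq_dividend[of "h b + s" N] dividend_less_div_times[OF assms(1), of "h b + s"]
      div_times_less_eq_dividend[of "h c + t" N] dividend_less_div_times[OF assms(1), of "h c + t"]
    unfolding i i_def[symmetric] by linarith+
  show ?thesis
  proof (cases "h b + N \<le> i * N")
    case True
    then have "b = c" by (rule eq(1))
    then show ?thesis using 1 by (auto simp: branch_dist_def xy)
  next
    case False
    then have 2: "i * N < h b + N" "i * N < h c + N" using eq(2) by auto
    then have 3: "s < 2 * N" "t < 2 * N" using 1 by auto
    have 4: "h b < h c + 2 * N" "h c < h b + 2 * N" using 1 2 by auto
    show ?thesis using 3 4 by (auto simp: branch_dist_def xy)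
  qed
qed

text \<open>Of two different cells in one annulus at most one is the remaining cell, so one of the
  points has height at least \<open>N\<close> on a branch that does not contain the other. Distinct
  annuli of equal parity have a full annulus of width \<open>N\<close> between them.\<close>

lemma branch_cell_separated:
  assumes "0 < N" "branch_cell h N x \<noteq> branch_cell h N y"
    and parity: "fst (branch_cell h N x) mod 2 = fst (branch_cell h N y) mod 2"
  shows "real N \<le> branch_dist h x y"
proof -
  obtain b s c t where xy: "x = (b, s)" "y = (c, t)" by fastforce
  define i j where "i = (h b + s) div N" and "j = (h c + t) div N"
  have 1: "i * N \<le> h b + s" "h b + s < i * N + N" "j * N \<le> h c + t" "h c + t < j * N + N"
    using div_times_less_eq_dividend[of "h b + s" N] dividend_less_div_times[OF assms(1), of "h b + s"]
      div_times_less_eq_dividend[of "h c + t" N] dividend_less_div_times[OF assms(1), of "h c + t"]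
    unfolding i_def[symmetric] j_def[symmetric] by linarith+
  show ?thesis
  proof (cases "i = j")
    case True
    then have "b \<noteq> c" "h b + N \<le> i * N \<or> h c + N \<le> i * N"
      using assms(2) by (auto simp: branch_cell_def xy Let_def i_def j_def split: if_splits)
    then have "N \<le> s \<or> N \<le> t" using 1 unfolding True by auto
    then show ?thesis using \<open>b \<noteq> c\<close> by (auto simp: branch_dist_def xy)
  next
    case False
    have "i mod 2 = j mod 2" using parity by (simp add: branch_cell_def xy Let_def i_def j_def)
    with False have "i + 2 \<le> j \<or> j + 2 \<le> i" by presburger
    then have "(i + 2) * N \<le> j * N \<or> (j + 2) * N \<le> i * N" using mult_le_mono1 by blast
    then have "h b + s + N \<le> h c + t \<or> h c + t + N \<le> h b + s" using 1 by auto
    then show ?thesis using branch_dist_height_diff[of h x y] by (auto simp: xy)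
  qed
qed

text \<open>The two discrete families are the cells of the even and of the odd annuli.\<close>

lemma asdim_branched_ray: "asdim_le (branched_ray B h) 1"
  unfolding asdim_le_def
proof (intro allI impI)
  fix D :: real assume "D > 0"
  define N where "N = nat \<lceil>D\<rceil>"
  have N: "0 < N" "D \<le> real N" using \<open>D > 0\<close> by (auto simp: N_def)
  \<comment> \<open>Values \<open>a\<close> that are not attained give the empty cell, which is
    harmless: its distance to any set is infinite.\<close>
  define C where "C a = {x \<in> B \<times> UNIV. branch_cell h N x = a}" for a
  define V where "V k = C ` {a. fst a mod 2 = k}" for k :: nat
  have "C a \<in> V (fst a mod 2)" "fst a mod 2 \<le> 1" for a by (auto simp: V_def)
  then have cover: "range C = (\<Union>k\<le>1. V k)" by (fastforce simp: V_def simp del: fst_conv)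
  have discrete: "discrete_family (branched_ray B h) D (V k)" for k
    unfolding discrete_family_def set_dist_ge_iff
  proof (intro ballI impI)
    fix A A' x y assume A: "A \<in> V k" "A' \<in> V k" "A \<noteq> A'" "x \<in> A" "y \<in> A'"
    then obtain a a' where "A = C a" "A' = C a'" "fst a mod 2 = k" "fst a' mod 2 = k"
      by (auto simp: V_def)
    then have "branch_cell h N x \<noteq> branch_cell h N y"
      "fst (branch_cell h N x) mod 2 = fst (branch_cell h N y) mod 2"
      using A by (auto simp: C_def)
    then have "real N \<le> branch_dist h x y" by (rule branch_cell_separated[OF N(1)])
    then show "D \<le> mdist (branched_ray B h) x y" using N(2) by simp
  qed
  have "\<Union>(range C) = mspace (branched_ray B h)" by (auto simp: C_def)
  moreover have "range C \<subseteq> Pow (mspace (branched_ray B h))" by (auto simp: C_def)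
  moreover have "uniformly_bounded (branched_ray B h) (range C)"
    unfolding uniformly_bounded_def
  proof (intro exI conjI ballI)
    show "0 < 6 * real N + 1" by simp
    fix A assume "A \<in> range C"
    then show "set_diam (branched_ray B h) A \<le> ennreal (6 * real N + 1)"
      using N(1) by (subst set_diam_le_iff) (auto simp: C_def intro!: branch_cell_bounded)
  qed
  moreover have "\<exists>\<V>. range C = (\<Union>i\<le>1::nat. \<V> i) \<and>
      (\<forall>i\<le>1. discrete_family (branched_ray B h) D (\<V> i))"
    by (intro exI[of _ V] conjI cover) (simp add: discrete)
  ultimately show "\<exists>\<U>. \<U> \<subseteq> Pow (mspace (branched_ray B h)) \<and> \<Union>\<U> = mspace (branched_ray B h) \<and>
      uniformly_bounded (branched_ray B h) \<U> \<and>
      (\<exists>\<V>. \<U> = (\<Union>i\<le>1::nat. \<V> i) \<and> (\<forall>i\<le>1. discrete_family (branched_ray B h) D (\<V> i)))"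
    by (intro exI[of _ "range C"] conjI)
qed

section \<open>Separated sets, chains and isometries\<close>

text \<open>A ball of radius \<open>1/2\<close> holds at most one point of a 1-separated set, so
  \<open>M\<close> can be the number of such balls in a finite cover, which total boundedness
  provides.\<close>

lemma proper_metric_separated_bound:
  fixes X :: "'a metric"
  assumes "proper_metric X" "p \<in> mspace X"
  obtains M where "\<And>S. S \<subseteq> mcball_of X p r \<Longrightarrow>
    (\<And>x y. x \<in> S \<Longrightarrow> y \<in> S \<Longrightarrow> x \<noteq> y \<Longrightarrow> 1 \<le> mdist X x y) \<Longrightarrow> card S \<le> M"
proof -
  interpret Metric_space "mspace X" "mdist X" by simp
  have "mtotally_bounded (mcball p r)"
    using assms unfolding proper_metric_def mtopology_of_def mcball_of_def
    by (blast intro: compactin_imp_mtotally_bounded)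
  then obtain K where K: "finite K" "mcball p r \<subseteq> (\<Union>x\<in>K. mball x (1/2))"
    unfolding mtotally_bounded_def by (meson half_gt_zero zero_less_one)
  have "card S \<le> card K" if S: "S \<subseteq> mcball_of X p r"
    and sep: "\<And>x y. x \<in> S \<Longrightarrow> y \<in> S \<Longrightarrow> x \<noteq> y \<Longrightarrow> 1 \<le> mdist X x y" for S
  proof -
    have "\<forall>x\<in>S. \<exists>z\<in>K. x \<in> mball z (1/2)" using S K(2) unfolding mcball_of_def by blast
    then obtain z where z: "\<And>x. x \<in> S \<Longrightarrow> z x \<in> K" "\<And>x. x \<in> S \<Longrightarrow> x \<in> mball (z x) (1/2)"
      by metis
    have "inj_on z S"
    proof (rule inj_onI, rule ccontr)
      fix x y assume xy: "x \<in> S" "y \<in> S" "z x = z y" "x \<noteq> y"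
      then have "x \<in> mball (z x) (1/2)" "y \<in> mball (z x) (1/2)" using z(2) by force+
      then have "mdist X x y < 1" using triangle'[of x "z x" y] by (auto simp: commute)
      then show False using sep xy by force
    qed
    then show ?thesis using card_inj_on_le z(1) K(1) by blast
  qed
  then show thesis using that by blast
qed

lemma mdist_chain:
  assumes "\<And>i. i \<le> n \<Longrightarrow> c i \<in> mspace X" "\<And>i. i < n \<Longrightarrow> mdist X (c i) (c (Suc i)) \<le> L"
  shows "mdist X (c 0) (c n) \<le> real n * L"
  using assms
proof (induction n)
  case 0
  then have "c 0 \<in> mspace X" by simp
  then show ?case by (simp add: Metric_space.mdist_zero[OF Metric_space_mspace_mdist])
next
  case (Suc n)
  have "mdist X (c 0) (c (Suc n)) \<le> mdist X (c 0) (c n) + mdist X (c n) (c (Suc n))"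
    using Suc.prems(1) by (intro mdist_triangle) auto
  also have "\<dots> \<le> real n * L + L" using Suc by (intro add_mono) auto
  finally show ?case by (simp add: algebra_simps)
qed

text \<open>With \<open>asdim_le_isometry\<close>, this allows replacing a branched ray by an
  isometric copy on a set of reals, the spaces over which the theorem quantifies.\<close>

lemma coarse_embedding_comp_isometry:
  assumes f: "coarse_embedding Y X f"
    and g: "g \<in> mspace Z \<rightarrow> mspace Y"
      "\<And>x y. x \<in> mspace Z \<Longrightarrow> y \<in> mspace Z \<Longrightarrow> mdist Y (g x) (g y) = mdist Z x y"
  shows "coarse_embedding Z X (f \<circ> g)"
proof -
  obtain \<phi> \<psi> where "f \<in> mspace Y \<rightarrow> mspace X" "control_function \<phi>" "control_function \<psi>"
    and "\<forall>x\<in>mspace Y. \<forall>y\<in>mspace Y. mdist X (f x) (f y) \<le> \<phi> (mdist Y x y)"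
    and "\<forall>x\<in>mspace Y. \<forall>y\<in>mspace Y. mdist X (f x) (f y) \<ge> \<psi> (mdist Y x y)"
    using f unfolding coarse_embedding_def coarsely_uniform_def by blast
  note f = this
  have "g x \<in> mspace Y" if "x \<in> mspace Z" for x using g(1) that by blast
  then have "f \<circ> g \<in> mspace Z \<rightarrow> mspace X"
    "\<forall>x\<in>mspace Z. \<forall>y\<in>mspace Z. mdist X ((f \<circ> g) x) ((f \<circ> g) y) \<le> \<phi> (mdist Z x y)"
    "\<forall>x\<in>mspace Z. \<forall>y\<in>mspace Z. mdist X ((f \<circ> g) x) ((f \<circ> g) y) \<ge> \<psi> (mdist Z x y)"
    using f(1,4,5) by (auto simp: g(2)[symmetric])
  then show ?thesis
    using f(2,3) unfolding coarse_embedding_def coarsely_uniform_def by blast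
qed

lemma asdim_le_isometry:
  assumes Z: "asdim_le Z n" and g: "bij_betw g (mspace Z) (mspace Y)"
    and iso: "\<forall>x\<in>mspace Z. \<forall>y\<in>mspace Z. mdist Y (g x) (g y) = mdist Z x y"
  shows "asdim_le Y n"
  unfolding asdim_le_def
proof (intro allI impI)
  fix D :: real assume "D > 0"
  then obtain \<U> \<V> where U: "\<U> \<subseteq> Pow (mspace Z)" "\<Union>\<U> = mspace Z" "uniformly_bounded Z \<U>"
    and V: "\<U> = (\<Union>i\<le>n. \<V> i)" "\<And>i. i \<le> n \<Longrightarrow> discrete_family Z D (\<V> i)"
    using Z unfolding asdim_le_def by meson
  have img: "g ` mspace Z = mspace Y" using g by (simp add: bij_betw_def)
  have sub: "A \<subseteq> mspace Z" if "A \<in> \<U>" for A using U(1) that by blast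
  have "\<Union>((`) g ` \<U>) = mspace Y"
    unfolding img[symmetric] U(2)[symmetric] by (rule image_Union[symmetric])
  moreover have "(`) g ` \<U> \<subseteq> Pow (mspace Y)"
    using sub unfolding img[symmetric] by auto
  moreover have "uniformly_bounded Y ((`) g ` \<U>)"
  proof -
    obtain M where "M > 0" "\<forall>A\<in>\<U>. set_diam Z A \<le> ennreal M"
      using U(3) unfolding uniformly_bounded_def by blast
    then have M: "M > 0" "\<And>A a b. A \<in> \<U> \<Longrightarrow> a \<in> A \<Longrightarrow> b \<in> A \<Longrightarrow> mdist Z a b \<le> M"
      by (auto simp: set_diam_le_iff)
    have "mdist Y (g a) (g b) \<le> M" if "A \<in> \<U>" "a \<in> A" "b \<in> A" for A a b
      using M(2)[OF that] sub[OF that(1)] that iso by (metis subsetD)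
    then have "\<forall>A\<in>(`) g ` \<U>. set_diam Y A \<le> ennreal M"
      using M(1) by (auto simp: set_diam_le_iff)
    then show ?thesis using M(1) unfolding uniformly_bounded_def by blast
  qed
  moreover have "discrete_family Y D ((`) g ` \<V> i)" if i: "i \<le> n" for i
    unfolding discrete_family_def set_dist_ge_iff
  proof (intro ballI impI)
    fix A A' x y assume A: "A \<in> (`) g ` \<V> i" "A' \<in> (`) g ` \<V> i" "A \<noteq> A'" "x \<in> A" "y \<in> A'"
    then obtain E E' a b where E: "E \<in> \<V> i" "E' \<in> \<V> i" "E \<noteq> E'" "a \<in> E" "b \<in> E'"
      "x = g a" "y = g b" by blast
    then have "D \<le> mdist Z a b"
      using V(2)[OF i] unfolding discrete_family_def set_dist_ge_iff by blast
    moreover have "a \<in> mspace Z" "b \<in> mspace Z" using E sub V(1) i by blast+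
    ultimately show "D \<le> mdist Y x y" using iso E by simp
  qed
  moreover have "(`) g ` \<U> = (\<Union>i\<le>n. (`) g ` \<V> i)" unfolding V(1) by blast
  ultimately show "\<exists>\<U>. \<U> \<subseteq> Pow (mspace Y) \<and> \<Union>\<U> = mspace Y \<and> uniformly_bounded Y \<U> \<and>
      (\<exists>\<V>. \<U> = (\<Union>i\<le>n. \<V> i) \<and> (\<forall>i\<le>n. discrete_family Y D (\<V> i)))"
    by (intro exI[of _ "(`) g ` \<U>"] conjI exI[of _ "\<lambda>i. (`) g ` \<V> i"]) auto
qed

section \<open>Non-embeddability\<close>

text \<open>The position \<open>n\<close> carries the branches \<open>(n, 0)\<close> to
  \<open>(n, K n)\<close>, one more than the number of 1-separated points that the ball can
  hold.\<close>

lemma fast_branched_ray_no_coarse_embedding: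
  fixes X :: "'a metric" and K :: "nat \<Rightarrow> nat"
  assumes p: "p \<in> mspace X"
    and K: "\<And>n S. S \<subseteq> mcball_of X p (real n * real (2 * n + 1) + real n) \<Longrightarrow>
      (\<And>x y. x \<in> S \<Longrightarrow> y \<in> S \<Longrightarrow> x \<noteq> y \<Longrightarrow> 1 \<le> mdist X x y) \<Longrightarrow> card S \<le> K n"
  shows "\<not> coarse_embedding (branched_ray (SIGMA n:UNIV. {..K n}) fst) X f"
proof
  let ?B = "SIGMA n:UNIV. {..K n}"
  assume "coarse_embedding (branched_ray ?B fst) X f"
  then obtain \<phi> \<psi> where f: "\<And>x. x \<in> ?B \<times> UNIV \<Longrightarrow> f x \<in> mspace X"
    and \<phi>: "control_function \<phi>" and \<psi>: "control_function \<psi>"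
    and upper: "\<And>x y. x \<in> ?B \<times> UNIV \<Longrightarrow> y \<in> ?B \<times> UNIV \<Longrightarrow>
      mdist X (f x) (f y) \<le> \<phi> (branch_dist fst x y)"
    and lower: "\<And>x y. x \<in> ?B \<times> UNIV \<Longrightarrow> y \<in> ?B \<times> UNIV \<Longrightarrow>
      \<psi> (branch_dist fst x y) \<le> mdist X (f x) (f y)"
    unfolding coarse_embedding_def coarsely_uniform_def by (auto simp: Pi_iff)
  let ?o = "((0, 0), 0) :: (nat \<times> nat) \<times> nat"
  obtain s where s: "\<And>t. s \<le> t \<Longrightarrow> 1 \<le> \<psi> t"
    using \<psi> unfolding control_function_def filterlim_at_top eventually_at_top_linorder by metis
  \<comment> \<open>The bound on \<open>\<phi> 2\<close> limits the image of a chain of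
    \<open>2 * n + 1\<close> steps to length \<open>n * (2 * n + 1)\<close>;
    \<open>s \<le> n\<close> separates the images of points at distance \<open>2 * n + 1\<close>;
    the last bound pays for moving the centre from \<open>f ?o\<close> to \<open>p\<close>.\<close>
  obtain n :: nat where n: "max (\<phi> 2) (max s (mdist X p (f ?o))) \<le> real n"
    using real_arch_simple by blast
  define L where "L = \<phi> 2"
  have step: "mdist X (f x) (f y) \<le> L"
    if "x \<in> ?B \<times> UNIV" "y \<in> ?B \<times> UNIV" "branch_dist fst x y \<le> 2" for x y
  proof -
    have "0 \<le> branch_dist fst x y" by (auto simp: branch_dist_def)
    then have "\<phi> (branch_dist fst x y) \<le> \<phi> 2"
      using \<phi> that(3) unfolding control_function_def by (auto elim!: mono_onD)
    then show ?thesis using upper[OF that(1,2)] by (simp add: L_def)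
  qed
  define S where "S = (\<lambda>k. f ((n, k), n)) ` {..K n}"
  have sep: "1 \<le> mdist X (f ((n, k), n)) (f ((n, l), n))" if "k \<le> K n" "l \<le> K n" "k \<noteq> l" for k l
  proof -
    have "s \<le> branch_dist fst ((n, k), n) ((n, l), n)"
      using n that by (simp add: branch_dist_def)
    then show ?thesis using s lower[of "((n, k), n)" "((n, l), n)"] that by force
  qed
  have "S \<subseteq> mcball_of X p (real n * real (2 * n + 1) + real n)"
  proof
    fix z assume "z \<in> S"
    then obtain k where k: "k \<le> K n" "z = f ((n, k), n)" by (auto simp: S_def)
    \<comment> \<open>Along the bases of the branches \<open>(0, 0), \<dots>, (n, 0)\<close>, and then up the branch \<open>(n, k)\<close>.\<close>
    define c where "c i = (if i \<le> n then ((i, 0), 0) else ((n, k), i - Suc n))" for i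
    have c: "c i \<in> ?B \<times> UNIV" for i using k(1) by (auto simp: c_def)
    \<comment> \<open>Length 2 occurs between consecutive bases: 1 for the positions and the summand
      1. With one change of branch at \<open>n\<close>, of length at most 1, the chain has
      \<open>n + 1 + n\<close> steps.\<close>
    have c_step: "branch_dist fst (c i) (c (Suc i)) \<le> 2" for i
      by (auto simp: c_def branch_dist_def not_le)
    have "mdist X (f (c 0)) (f (c (2 * n + 1))) \<le> real (2 * n + 1) * L"
      by (rule mdist_chain[where c = "\<lambda>i. f (c i)"]) (rule f[OF c], rule step[OF c c c_step])
    then have "mdist X (f ?o) z \<le> real (2 * n + 1) * L"
      using k(2) by (simp add: c_def)
    also have "\<dots> \<le> real (2 * n + 1) * real n"
      using n by (intro mult_left_mono) (auto simp: L_def)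
    finally have "mdist X (f ?o) z \<le> real (2 * n + 1) * real n" .
    moreover have "f ?o \<in> mspace X" "z \<in> mspace X" using f k by auto
    moreover from this have "mdist X p z \<le> mdist X p (f ?o) + mdist X (f ?o) z"
      using p by (intro mdist_triangle)
    ultimately show "z \<in> mcball_of X p (real n * real (2 * n + 1) + real n)"
      using p n by (simp add: mult.commute)
  qed
  moreover have "1 \<le> mdist X x y" if "x \<in> S" "y \<in> S" "x \<noteq> y" for x y
    using that sep unfolding S_def by auto
  ultimately have "card S \<le> K n" by (rule K)
  moreover have "inj_on (\<lambda>k. f ((n, k), n)) {..K n}"
  proof (rule inj_onI, rule ccontr)
    fix k l assume kl: "k \<in> {..K n}" "l \<in> {..K n}" "f ((n, k), n) = f ((n, l), n)" "k \<noteq> l"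
    then have "f ((n, l), n) \<in> mspace X" using f by auto
    then have "mdist X (f ((n, k), n)) (f ((n, l), n)) = 0"
      using kl(3) by (simp add: Metric_space.mdist_zero[OF Metric_space_mspace_mdist])
    then show False using sep[of k l] kl by simp
  qed
  then have "card S = K n + 1" by (simp add: S_def card_image)
  ultimately show False by simp
qed

theorem theorem3p1:
  shows "\<not> (\<exists>X :: 'a metric. proper_metric X \<and>
    (\<forall>Y :: real metric. proper_metric Y \<and> asdim_le Y 1 \<longrightarrow> (\<exists>f. coarse_embedding Y X f)))"
proof
  assume "\<exists>X :: 'a metric. proper_metric X \<and>
    (\<forall>Y :: real metric. proper_metric Y \<and> asdim_le Y 1 \<longrightarrow> (\<exists>f. coarse_embedding Y X f))"
  then obtain X :: "'a metric" where X: "proper_metric X"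
    and univ: "\<And>Y :: real metric. proper_metric Y \<Longrightarrow> asdim_le Y 1 \<Longrightarrow> \<exists>f. coarse_embedding Y X f"
    by blast
  have embeds: "\<exists>f. coarse_embedding (branched_ray (SIGMA n:UNIV. {..K n}) fst) X f"
    for K :: "nat \<Rightarrow> nat"
  proof -
    let ?Z = "branched_ray (SIGMA n:UNIV. {..K n}) fst"
    have "finite {b \<in> (SIGMA n:UNIV. {..K n}). fst b = n}" for n
      by (rule finite_subset[of _ "{n} \<times> {..K n}"]) auto
    then have "proper_metric ?Z" by (rule proper_metric_branched_ray)
    then obtain Y :: "real metric" and g where Y: "proper_metric Y"
      and g: "bij_betw g (mspace ?Z) (mspace Y)"
      and iso: "\<forall>x\<in>mspace ?Z. \<forall>y\<in>mspace ?Z. mdist Y (g x) (g y) = mdist ?Z x y"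
      using proper_metric_isometric_real by blast
    have "asdim_le Y 1" using asdim_le_isometry[OF asdim_branched_ray g iso] .
    then obtain f where "coarse_embedding Y X f" using univ Y by blast
    then have "coarse_embedding ?Z X (f \<circ> g)"
      using g iso by (intro coarse_embedding_comp_isometry) (auto simp: bij_betw_def)
    then show ?thesis by blast
  qed
  \<comment> \<open>The definition of \<open>K\<close> needs a centre \<open>p\<close>, and
    \<open>X\<close> is not known to be nonempty; embedding one branched ray supplies a
    point.\<close>
  obtain f where "coarse_embedding (branched_ray (SIGMA n:UNIV. {..(0::nat)}) fst) X f"
    using embeds[of "\<lambda>_. 0"] by blast
  then have "f ((0, 0), 0) \<in> mspace X"
    unfolding coarse_embedding_def coarsely_uniform_def by auto
  then obtain p where p: "p \<in> mspace X" by blast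
  have "\<exists>M. \<forall>S \<subseteq> mcball_of X p r. (\<forall>x\<in>S. \<forall>y\<in>S. x \<noteq> y \<longrightarrow> 1 \<le> mdist X x y) \<longrightarrow> card S \<le> M" for r
    using proper_metric_separated_bound[OF X p, of r] by metis
  then obtain M where M: "\<And>r S. S \<subseteq> mcball_of X p r \<Longrightarrow>
      (\<And>x y. x \<in> S \<Longrightarrow> y \<in> S \<Longrightarrow> x \<noteq> y \<Longrightarrow> 1 \<le> mdist X x y) \<Longrightarrow> card S \<le> M r"
    by metis
  \<comment> \<open>The radius depends on \<open>n\<close> alone, so \<open>K\<close> is fixed
    before any embedding and its control functions are given.\<close>
  define K where "K n = M (real n * real (2 * n + 1) + real n)" for n :: nat
  have "\<not> coarse_embedding (branched_ray (SIGMA n:UNIV. {..K n}) fst) X f" for f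
    unfolding K_def by (rule fast_branched_ray_no_coarse_embedding[OF p M])
  then show False using embeds by blast
qed

end
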